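(* Let $\rho<0$, $\alpha\ge0$, $\theta\in(\frac{\pi}{2},\pi)$ and define $$\mu=\frac{1-(1-2\alpha\rho)^2\sin^2(\theta)}{4\rho}.$$ Then $\mathcal{B}_\theta+\alpha\,\mathrm{id}\subseteq\mathcal{S}_{\mu,\rho}$; that is, for every $\theta$-angle-bounded operator $A$ on a Hilbert space, $A+\alpha\,\mathrm{id}$ is $(\mu,\rho)$-semimonotone.
   Context: Hilbert spaces are real. For a set-valued operator $A:\mathcal{H}\rightrightarrows\mathcal{H}$ on a Hilbert space, its graph is $\operatorname{gph}A=\{(x,u)\in\mathcal{H}\times\mathcal{H}: u\in A(x)\}$; $\mathrm{id}$ is the identity operator, and $(A+\alpha\,\mathrm{id})(x)=\{u+\alpha x:u\in A(x)\}$. For $a,b\in\mathcal{H}$ let $\angle(a,b)=\arccos\left(\frac{\langle a,b\rangle}{\|a\|\|b\|}\right)$ if $a\ne0$ and $b\ne0$, and $\angle(a,b)=0$ otherwise. $A$ is $\theta$-angle-bounded if $\angle(x-y,u-v)\le\theta$ for all $(x,u),(y,v)\in\operatorname{gph}A$ (equivalently $\langle x-y,u-v\rangle\ge\cos(\theta)\|x-y\|\|u-v\|$ for all such pairs). $\mathcal{B}_\theta$ is the class of all $\theta$-angle-bounded operators, and $\mathcal{B}_\theta+\alpha\,\mathrm{id}=\{A+\alpha\,\mathrm{id}:A\in\mathcal{B}_\theta\}$. $A$ is $(\mu,\rho)$-semimonotone if $\langle x-y,u-v\rangle\ge\mu\|x-y\|^2+\rho\|u-v\|^2$ for all $(x,u),(y,v)\in\operatorname{gph}A$;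 $\mathcal{S}_{\mu,\rho}$ is the class of all such operators. *)

theory Defs
  imports "HOL-Analysis.Analysis"
begin

definition gph :: "('a \<Rightarrow> 'b set) \<Rightarrow> ('a \<times> 'b) set" where
  "gph A = {(x, u). u \<in> A x}"

definition angle :: "'a::real_inner \<Rightarrow> 'a \<Rightarrow> real" where
  "angle a b =
    (if a \<noteq> 0 \<and> b \<noteq> 0 then arccos (inner a b / (norm a * norm b)) else 0)"

definition angle_bounded :: "real \<Rightarrow> ('a::real_inner \<Rightarrow> 'a set) \<Rightarrow> bool" where
  "angle_bounded \<theta> A \<longleftrightarrow>
    (\<forall>(x, u) \<in> gph A. \<forall>(y, v) \<in> gph A. angle (x - y) (u - v) \<le> \<theta>)"

definition angle_bounded_class :: "real \<Rightarrow> ('a::real_inner \<Rightarrow> 'a set) set" where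
  "angle_bounded_class \<theta> = {A. angle_bounded \<theta> A}"

definition semimonotone :: "real \<Rightarrow> real \<Rightarrow> ('a::real_inner \<Rightarrow> 'a set) \<Rightarrow> bool" where
  "semimonotone \<mu> \<rho> A \<longleftrightarrow>
    (\<forall>(x, u) \<in> gph A. \<forall>(y, v) \<in> gph A.
      inner (x - y) (u - v) \<ge> \<mu> * (norm (x - y))\<^sup>2 + \<rho> * (norm (u - v))\<^sup>2)"

definition semimonotone_class :: "real \<Rightarrow> real \<Rightarrow> ('a::real_inner \<Rightarrow> 'a set) set" where
  "semimonotone_class \<mu> \<rho> = {A. semimonotone \<mu> \<rho> A}"

definition add_scaled_id ::
  "('a::real_vector \<Rightarrow> 'a set) \<Rightarrow> real \<Rightarrow> 'a \<Rightarrow> 'a set" where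
  "add_scaled_id A \<alpha> = (\<lambda>x. {u + \<alpha> *\<^sub>R x | u. u \<in> A x})"

end

theory Submission imports Defs begin

text \<open>
  Fix two points of the graph of \<open>A + \<alpha> id\<close>, and let \<open>d\<close> and \<open>w\<close> be the differences of the
  arguments and of the corresponding values of \<open>A\<close>. Put \<open>k = 1 - 2 \<alpha> \<rho>\<close>. Expanding
  the semimonotonicity inequality for \<open>d\<close> and \<open>w + \<alpha> d\<close> turns it into
  \<open>k \<langle>d, w\<rangle> - k\<^sup>2 cos\<^sup>2 \<theta> \<parallel>d\<parallel>\<^sup>2 / (4 \<rho>) - \<rho> \<parallel>w\<parallel>\<^sup>2 \<ge> 0\<close>,
  because the value of \<open>\<mu>\<close> gives exactly \<open>\<alpha> - \<mu> - \<rho> \<alpha>\<^sup>2 = - k\<^sup>2 cos\<^sup>2 \<theta> / (4 \<rho>)\<close>.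
  Since \<open>k > 0\<close>, the bound \<open>\<langle>d, w\<rangle> \<ge> cos \<theta> \<parallel>d\<parallel> \<parallel>w\<parallel>\<close> may be inserted, and what
  remains is the perfect square \<open>(k cos \<theta> \<parallel>d\<parallel> - 2 \<rho> \<parallel>w\<parallel>)\<^sup>2\<close> divided by \<open>- 4 \<rho> > 0\<close>.
  The lemma \<open>inner_ge_if_angle_le\<close> gives the first bound, and \<open>semimonotone_inequality_shift\<close>
  the completed square.
\<close>

text \<open>
  Cosine is decreasing on \<open>[0, \<pi>]\<close>, and the Cauchy--Schwarz inequality places the argument
  of \<open>arccos\<close> in its domain. If one vector vanishes, both sides are \<open>0\<close>.
\<close>

lemma inner_ge_if_angle_le:
  fixes a b :: "'a::real_inner"
  assumes "angle a b \<le> \<theta>" and "\<theta> \<le> pi"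
  shows "cos \<theta> * (norm a * norm b) \<le> inner a b"
proof (cases "a = 0 \<or> b = 0")
  case True
  then show ?thesis by auto
next
  case False
  define t where "t = inner a b / (norm a * norm b)"
  have pos: "norm a * norm b > 0"
    using False by simp
  have "\<bar>t\<bar> \<le> 1"
    using Cauchy_Schwarz_ineq2[of a b] pos by (simp add: t_def abs_mult)
  then have t: "-1 \<le> t" "t \<le> 1"
    by auto
  have "arccos t \<le> \<theta>"
    using assms(1) False by (simp add: angle_def t_def)
  then have "cos \<theta> \<le> cos (arccos t)"
    using cos_monotone_0_pi_le[OF arccos_lbound[OF t]] assms(2) by simp
  then have "cos \<theta> \<le> t"
    using t by simp
  then show ?thesis
    using pos by (simp add: t_def pos_le_divide_eq)
qed

text \<open>
  The pointwise form of the theorem, with \<open>cos \<theta>\<close> replaced by a real number \<open>c\<close>.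
  The assumption \<open>2 * \<alpha> * \<rho> \<le> 1\<close> says that the coefficient of \<open>inner d w\<close> is nonnegative,
  so that a lower bound on \<open>inner d w\<close> can be used.
\<close>

lemma semimonotone_inequality_shift:
  fixes d w :: "'a::real_inner" and \<rho> \<alpha> c :: real
  assumes "\<rho> < 0" and "2 * \<alpha> * \<rho> \<le> 1"
    and bound: "c * (norm d * norm w) \<le> inner d w"
  shows "(1 - (1 - 2 * \<alpha> * \<rho>)\<^sup>2 * (1 - c\<^sup>2)) / (4 * \<rho>) * (norm d)\<^sup>2
           + \<rho> * (norm (w + \<alpha> *\<^sub>R d))\<^sup>2
         \<le> inner d (w + \<alpha> *\<^sub>R d)"
proof -
  define k where "k = 1 - 2 * \<alpha> * \<rho>"
  define \<mu> where "\<mu> = (1 - k\<^sup>2 * (1 - c\<^sup>2)) / (4 * \<rho>)"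
  define p q where "p = norm d" and "q = norm w"
  have norm_shift: "(norm (w + \<alpha> *\<^sub>R d))\<^sup>2 = q\<^sup>2 + 2 * \<alpha> * inner d w + \<alpha>\<^sup>2 * p\<^sup>2"
    unfolding p_def q_def power2_norm_eq_inner
    by (simp add: inner_add_left inner_add_right inner_commute power2_eq_square algebra_simps)
  have inner_shift: "inner d (w + \<alpha> *\<^sub>R d) = inner d w + \<alpha> * p\<^sup>2"
    by (simp add: p_def inner_add_right power2_norm_eq_inner)
  have coeff: "\<alpha> - \<mu> - \<rho> * \<alpha>\<^sup>2 = k\<^sup>2 * c\<^sup>2 / (- 4 * \<rho>)"
    using assms(1) unfolding \<mu>_def k_def by (simp add: field_simps power2_eq_square)
  have "0 \<le> (k * c * p - 2 * \<rho> * q)\<^sup>2 / (- 4 * \<rho>)"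
    using assms(1) by (intro divide_nonneg_pos) auto
  also have "\<dots> = k * (c * (p * q)) + k\<^sup>2 * c\<^sup>2 / (- 4 * \<rho>) * p\<^sup>2 - \<rho> * q\<^sup>2"
    using assms(1) by (simp add: field_simps power2_eq_square)
  also have "\<dots> \<le> k * inner d w + k\<^sup>2 * c\<^sup>2 / (- 4 * \<rho>) * p\<^sup>2 - \<rho> * q\<^sup>2"
    using mult_left_mono[OF bound, of k] assms(2) by (simp add: k_def p_def q_def)
  also have "\<dots> = inner d (w + \<alpha> *\<^sub>R d) - \<mu> * p\<^sup>2 - \<rho> * (norm (w + \<alpha> *\<^sub>R d))\<^sup>2"
    unfolding norm_shift inner_shift coeff[symmetric] by (simp add: k_def algebra_simps)
  finally show ?thesis
    by (simp add: \<mu>_def k_def p_def)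
qed

theorem proposition6:
  fixes \<rho> \<alpha> \<theta> \<mu> :: real
  assumes "\<rho> < 0" and "\<alpha> \<ge> 0" and "\<theta> \<in> {pi / 2 <..< pi}"
    and "\<mu> = (1 - (1 - 2 * \<alpha> * \<rho>)\<^sup>2 * (sin \<theta>)\<^sup>2) / (4 * \<rho>)"
  shows "{add_scaled_id A \<alpha> | A :: 'a::{real_inner, complete_space} \<Rightarrow> 'a set.
            A \<in> angle_bounded_class \<theta>} \<subseteq> semimonotone_class \<mu> \<rho>"
proof -
  have "\<alpha> * \<rho> \<le> 0"
    using assms(1,2) by (simp add: mult_nonneg_nonpos)
  then have coeff_nonneg: "2 * \<alpha> * \<rho> \<le> 1"
    by simp
  have \<mu>: "\<mu> = (1 - (1 - 2 * \<alpha> * \<rho>)\<^sup>2 * (1 - (cos \<theta>)\<^sup>2)) / (4 * \<rho>)"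
    by (simp add: assms(4) sin_squared_eq)
  have "semimonotone \<mu> \<rho> (add_scaled_id A \<alpha>)"
    if A: "angle_bounded \<theta> A" for A :: "'a \<Rightarrow> 'a set"
  proof -
    have "\<mu> * (norm (x - y))\<^sup>2 + \<rho> * (norm ((u + \<alpha> *\<^sub>R x) - (v + \<alpha> *\<^sub>R y)))\<^sup>2
            \<le> inner (x - y) ((u + \<alpha> *\<^sub>R x) - (v + \<alpha> *\<^sub>R y))"
      if "u \<in> A x" "v \<in> A y" for x y u v
    proof -
      have "angle (x - y) (u - v) \<le> \<theta>"
        using A that by (auto simp: angle_bounded_def gph_def)
      then have "cos \<theta> * (norm (x - y) * norm (u - v)) \<le> inner (x - y) (u - v)"
        using assms(3) by (intro inner_ge_if_angle_le) auto
      from semimonotone_inequality_shift[OF assms(1) coeff_nonneg this]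
      have "\<mu> * (norm (x - y))\<^sup>2 + \<rho> * (norm ((u - v) + \<alpha> *\<^sub>R (x - y)))\<^sup>2
              \<le> inner (x - y) ((u - v) + \<alpha> *\<^sub>R (x - y))"
        by (simp only: \<mu>)
      moreover have "(u + \<alpha> *\<^sub>R x) - (v + \<alpha> *\<^sub>R y) = (u - v) + \<alpha> *\<^sub>R (x - y)"
        by (simp add: scaleR_diff_right)
      ultimately show ?thesis
        by (simp only:)
    qed
    then show ?thesis
      by (auto simp: semimonotone_def gph_def add_scaled_id_def)
  qed
  then show ?thesis
    by (auto simp: angle_bounded_class_def semimonotone_class_def)
qed

end
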